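(* Let $r\ge3$ and $k\ge r+1$, and let $a_1,\dots,a_k$ be nonzero integers. Then the equation $\sum_{i=1}^k a_ix_i=0$ is not $r$-graph-regular: there is a finite coloring of the $r$-element subsets of $\mathbb{N}$ such that there are no pairwise distinct positive integers $x_1,\dots,x_k$ with $\sum_i a_ix_i=0$ for which all $r$-element subsets of $\{x_1,\dots,x_k\}$ receive the same color.
   Context: An equation $\sum_{i=1}^k a_ix_i=0$ (integer coefficients, $k\ge r+1$) is called $r$-graph-regular if for every finite coloring of the $r$-element subsets of $\mathbb{N}$ there exist pairwise distinct positive integers $x_1,\dots,x_k$ with $\sum a_ix_i=0$ such that all $r$-element subsets of $\{x_1,\dots,x_k\}$ have the same color. *)

theory Defs
  imports Complex_Main "HOL-Library.Ramsey" "HOL-Library.FuncSet"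
begin

definition graph_regular :: "nat \<Rightarrow> nat \<Rightarrow> (nat \<Rightarrow> int) \<Rightarrow> bool" where
  \<comment> \<open>The equation has coefficients \<open>a 1, \<dots>, a k\<close>; only the restrictions of \<open>a\<close> and of the
     solution \<open>x\<close> to \<open>{1..k}\<close> matter. The set being coloured is that of the positive
     integers, and the colours are the numbers below \<open>m\<close>.\<close>
  "graph_regular r k a \<longleftrightarrow>
     (\<forall>(m::nat) (c :: nat set \<Rightarrow> nat). c \<in> [{1..}]\<^bsup>r\<^esup> \<rightarrow> {..<m} \<longrightarrow>
        (\<exists>x :: nat \<Rightarrow> nat.
           (\<forall>i\<in>{1..k}. x i > 0) \<and> inj_on x {1..k} \<and>
           (\<Sum>i=1..k. a i * int (x i)) = 0 \<and>
           (\<exists>t. \<forall>S\<in>[x ` {1..k}]\<^bsup>r\<^esup>. c S = t)))"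

end

theory Submission
  imports Defs "HOL-Computational_Algebra.Primes" "HOL-Library.Discrete_Functions"
    "HOL-Library.Sublist"
begin

text \<open>
  Fix a prime \<open>p\<close> larger than \<open>\<Sum>\<bar>a\<^sub>i\<bar>\<close> and let \<open>y\<^sub>0 < \<dots> < y\<^sub>n\<close> be a monochromatic solution, with
  coefficients permuted to \<open>b\<^sub>0, \<dots>, b\<^sub>n\<close>. Colouring pairs by the comparison of their \<open>p\<close>-adic
  valuations makes the valuations of the \<open>y\<^sub>j\<close> strictly monotone or constant. In the monotone case
  a single term has minimal valuation, so the sum is not \<open>0\<close>. In the constant case the last nonzero
  base-\<open>p\<close> digits, which are also part of the colour, are all equal, so \<open>p\<close> divides \<open>\<Sum>b\<^sub>j\<close> and
  hence \<open>\<Sum>b\<^sub>j = 0\<close>. Then only the gaps \<open>y\<^bsub>j+1\<^esub> - y\<^sub>j\<close> matter. Their binary logarithms are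
  congruent modulo \<open>p + 2\<close>. They are not all equal, since two consecutive gaps of equal logarithm
  add up to one whose logarithm is larger by exactly \<open>1\<close>, and the pair \<open>y\<^sub>0, y\<^sub>2\<close> has the same
  colour as \<open>y\<^sub>0, y\<^sub>1\<close>. As triples record the comparison of consecutive gaps, the gaps grow or
  decay geometrically, and the largest one dominates the sum.
\<close>

section \<open>The colouring\<close>

text \<open>Two truth values encode the trichotomy, with \<open>(False, False)\<close> for equality,
  so a comparison contributes only finitely many colours.\<close>

definition cmp :: "nat \<Rightarrow> nat \<Rightarrow> bool \<times> bool" where
  "cmp m n = (m < n, n < m)"

definition last_nonzero_digit :: "nat \<Rightarrow> nat \<Rightarrow> nat" where
  "last_nonzero_digit p n = n div p ^ multiplicity p n mod p"

type_synonym pair_colour = "(nat \<times> nat) \<times> (bool \<times> bool) \<times> nat"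

text \<open>The modulus \<open>p + 2\<close> serves twice: it exceeds 1, so logarithms that differ
  by one have different residues, and distinct congruent logarithms differ by at least
  \<open>p + 2\<close>, which separates the gaps by a factor of at least
  \<open>2 * p\<close>.\<close>

definition pair_colour :: "nat \<Rightarrow> nat \<Rightarrow> nat \<Rightarrow> pair_colour" where
  "pair_colour p x y =
     ((last_nonzero_digit p x, last_nonzero_digit p y), cmp (multiplicity p x) (multiplicity p y),
      floor_log (y - x) mod (p + 2))"

definition triple_colour ::
  "nat \<Rightarrow> nat \<Rightarrow> nat \<Rightarrow> nat \<Rightarrow> pair_colour \<times> pair_colour \<times> bool \<times> bool" where
  "triple_colour p x y z =
     (pair_colour p x y, pair_colour p y z, cmp (floor_log (y - x)) (floor_log (z - y)))"

text \<open>Recording the triples at all \<open>r - 2\<close> positions lets every two neighbouring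
  triples of a solution be compared, even when \<open>k = r + 1\<close> leaves room for only two
  windows of length \<open>r\<close>.\<close>

definition set_colour ::
  "nat \<Rightarrow> nat \<Rightarrow> nat set \<Rightarrow> (pair_colour \<times> pair_colour \<times> bool \<times> bool) list" where
  "set_colour p r S =
     (let l = sorted_list_of_set S in
      map (\<lambda>i. triple_colour p (l ! i) (l ! (i + 1)) (l ! (i + 2))) [0..<r - 2])"

section \<open>Valuations and last nonzero digits\<close>

text \<open>With \<open>v\<close> the minimal valuation, \<open>p ^ Suc v\<close> divides every term
  except the one at \<open>m\<close>, so it cannot divide the sum.\<close>

lemma sum_neq_0_unique_min_multiplicity:
  fixes y :: "nat \<Rightarrow> nat" and b :: "nat \<Rightarrow> int"
  assumes "prime p" "finite I" "m \<in> I" "y m > 0" "\<not> int p dvd b m"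
    and min: "\<And>j. j \<in> I - {m} \<Longrightarrow> multiplicity p (y m) < multiplicity p (y j)"
  shows "(\<Sum>j\<in>I. b j * int (y j)) \<noteq> 0"
proof
  assume eq: "(\<Sum>j\<in>I. b j * int (y j)) = 0"
  define v where "v = multiplicity p (y m)"
  have "int (p ^ Suc v) dvd b j * int (y j)" if "j \<in> I - {m}" for j
  proof -
    have "p ^ Suc v dvd y j"
      using min[OF that] by (intro multiplicity_dvd') (auto simp: v_def)
    then show ?thesis
      by (metis dvd_mult int_dvd_int_iff)
  qed
  then have "int (p ^ Suc v) dvd (\<Sum>j\<in>I - {m}. b j * int (y j))"
    by (intro dvd_sum)
  moreover have "(\<Sum>j\<in>I. b j * int (y j)) = b m * int (y m) + (\<Sum>j\<in>I - {m}. b j * int (y j))"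
    using assms by (simp add: sum.remove)
  ultimately have "int (p ^ Suc v) dvd b m * int (y m)"
    using eq by (metis dvd_0_right dvd_add_left_iff)
  moreover have "y m = p ^ v * (y m div p ^ v)"
    by (simp add: v_def multiplicity_dvd)
  ultimately have "int (p ^ v) * int p dvd int (p ^ v) * (b m * int (y m div p ^ v))"
    by (metis (no_types, lifting) of_nat_mult mult.left_commute power_Suc2)
  then have "int p dvd b m * int (y m div p ^ v)"
    using \<open>prime p\<close> by (simp add: prime_gt_0_nat)
  then have "p dvd y m div p ^ v"
    using assms by (metis int_dvd_int_iff prime_dvd_mult_iff prime_nat_int_transfer)
  moreover have "\<not> is_unit p" "y m \<noteq> 0"
    using assms not_prime_unit by auto
  ultimately show False
    using multiplicity_decompose unfolding v_def by blast
qed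

text \<open>After division by the common power of \<open>p\<close>, all cofactors are congruent to
  the same digit \<open>u\<close> modulo \<open>p\<close>. The equation becomes \<open>u\<close>
  times the coefficient sum, and \<open>u\<close> is invertible modulo \<open>p\<close>.\<close>

lemma prime_dvd_coeff_sum_if_same_multiplicity:
  fixes y :: "nat \<Rightarrow> nat" and b :: "nat \<Rightarrow> int"
  assumes "prime p" "finite I" "m \<in> I" "y m > 0"
    and mult: "\<And>j. j \<in> I \<Longrightarrow> multiplicity p (y j) = multiplicity p (y m)"
    and digit: "\<And>j. j \<in> I \<Longrightarrow> last_nonzero_digit p (y j) = last_nonzero_digit p (y m)"
    and eq: "(\<Sum>j\<in>I. b j * int (y j)) = 0"
  shows "int p dvd (\<Sum>j\<in>I. b j)"
proof -
  define v u where "v = multiplicity p (y m)" and "u = last_nonzero_digit p (y m)"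
  define w where "w j = y j div p ^ v" for j
  have y: "y j = p ^ v * w j" if "j \<in> I" for j
    using mult[OF that] unfolding w_def v_def
    by (metis dvd_mult_div_cancel multiplicity_dvd)
  have u: "w j mod p = u" if "j \<in> I" for j
    using digit[OF that] mult[OF that] by (simp add: u_def last_nonzero_digit_def w_def v_def)
  have "\<not> is_unit p" "y m \<noteq> 0"
    using assms not_prime_unit by auto
  then have "\<not> p dvd w m"
    using multiplicity_decompose unfolding w_def v_def by blast
  then have nu: "\<not> int p dvd int u"
    using u[OF \<open>m \<in> I\<close>] by (metis dvd_mod_iff dvd_refl int_dvd_int_iff)
  have "(\<Sum>j\<in>I. b j * int (y j)) = int (p ^ v) * (\<Sum>j\<in>I. b j * int (w j))"
    by (simp add: y sum_distrib_left mult_ac)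
  then have "(\<Sum>j\<in>I. b j * int (w j)) = 0"
    using eq \<open>prime p\<close> by (simp add: prime_gt_0_nat)
  moreover have "int p dvd (\<Sum>j\<in>I. b j * int (w j) - b j * int u)"
  proof (intro dvd_sum)
    fix j assume "j \<in> I"
    then have "int p dvd int (w j) - int u"
      by (metis u dvd_minus_mod mod_mod_trivial mod_eq_dvd_iff of_nat_mod)
    then show "int p dvd b j * int (w j) - b j * int u"
      by (metis dvd_mult right_diff_distrib)
  qed
  ultimately have "int p dvd (\<Sum>j\<in>I. b j) * int u"
    by (simp add: sum_subtractf sum_distrib_right)
  then show ?thesis
    using nu \<open>prime p\<close> by (simp add: prime_dvd_mult_iff)
qed

section \<open>Sums over points with rapidly growing gaps\<close>

text \<open>The last gap is at least \<open>M\<close> times the spread of all earlier points, so the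
  term at \<open>n\<close> outweighs the others once distances are measured from
  \<open>z 0\<close>.\<close>

lemma sum_neq_0_lacunary:
  fixes z b :: "nat \<Rightarrow> int"
  assumes n: "n \<ge> 1"
    and inc: "\<And>j. j < n \<Longrightarrow> z j < z (Suc j)"
    and lac: "\<And>j. Suc j < n \<Longrightarrow> 2 * M * (z (Suc j) - z j) \<le> z (Suc (Suc j)) - z (Suc j)"
    and M: "(\<Sum>j\<le>n. \<bar>b j\<bar>) \<le> M"
    and b: "(\<Sum>j\<le>n. b j) = 0" "b n \<noteq> 0"
  shows "(\<Sum>j\<le>n. b j * z j) \<noteq> 0"
proof
  assume eq: "(\<Sum>j\<le>n. b j * z j) = 0"
  obtain k where k: "n = Suc k"
    using n by (cases n) auto
  have "1 \<le> \<bar>b n\<bar>"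
    using b by auto
  also have "\<dots> \<le> M"
    using M member_le_sum[of n "{..n}" "\<lambda>j. \<bar>b j\<bar>"] by auto
  finally have "1 \<le> M" .
  have mono: "z 0 \<le> z j \<and> z j \<le> z k" if "j \<le> k" for j
  proof
    show "z 0 \<le> z j"
      using that
    proof (induction j)
      case (Suc i)
      with inc[of i] k show ?case by simp
    qed simp
    show "z j \<le> z k"
      using that
    proof (induction j rule: inc_induct)
      case (step i)
      with inc[of i] k show ?case by simp
    qed simp
  qed
  \<comment> \<open>The induction hypothesis bounds the earlier spread by the current gap, so adding
    that gap gives a spread of at most twice the gap. The factor 2 in \<open>lac\<close> absorbs
    this.\<close>
  have small: "j < n \<Longrightarrow> M * (z j - z 0) \<le> z (Suc j) - z j" for j
  proof (induction j)
    case 0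
    then show ?case using inc[of 0] by simp
  next
    case (Suc j)
    then have IH: "M * (z j - z 0) \<le> z (Suc j) - z j" by simp
    have "z j - z 0 \<le> M * (z j - z 0)"
      using mono[of j] Suc.prems k \<open>1 \<le> M\<close> by (simp add: mult_le_cancel_right1)
    from order_trans[OF this IH] have "z (Suc j) - z 0 \<le> 2 * (z (Suc j) - z j)"
      by simp
    then have "M * (z (Suc j) - z 0) \<le> M * (2 * (z (Suc j) - z j))"
      using \<open>1 \<le> M\<close> by (intro mult_left_mono) auto
    also have "\<dots> \<le> z (Suc (Suc j)) - z (Suc j)"
      using lac[OF Suc.prems] by (simp add: mult_ac)
    finally show ?case .
  qed
  define E D where "E = z k - z 0" and "D = z n - z k"
  have "M * E \<le> D" "D > 0" "E \<ge> 0"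
    using small[of k] inc[of k] mono[of k] k by (auto simp: E_def D_def)
  \<comment> \<open>A vanishing coefficient sum permits moving the origin to
    \<open>z 0\<close>.\<close>
  have "(\<Sum>j\<le>n. b j * (z j - z 0)) = 0"
    using eq b by (simp add: right_diff_distrib sum_subtractf flip: sum_distrib_right)
  then have "b n * (D + E) = - (\<Sum>j\<le>k. b j * (z j - z 0))"
    by (simp add: k D_def E_def)
  then have "\<bar>b n\<bar> * (D + E) = \<bar>\<Sum>j\<le>k. b j * (z j - z 0)\<bar>"
    using \<open>D > 0\<close> \<open>E \<ge> 0\<close> by (metis abs_minus_cancel abs_mult abs_of_nonneg add_nonneg_nonneg less_imp_le)
  also have "\<dots> \<le> (\<Sum>j\<le>k. \<bar>b j\<bar> * E)"
  proof (intro order_trans[OF sum_abs] sum_mono)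
    fix j assume "j \<in> {..k}"
    then show "\<bar>b j * (z j - z 0)\<bar> \<le> \<bar>b j\<bar> * E"
      using mono[of j] by (auto simp: abs_mult E_def intro!: mult_left_mono)
  qed
  also have "\<dots> \<le> M * E"
    unfolding sum_distrib_right[symmetric]
    using M \<open>E \<ge> 0\<close> by (intro mult_right_mono) (auto simp: k)
  finally have "\<bar>b n\<bar> * (D + E) \<le> M * E" .
  moreover have "D + E \<le> \<bar>b n\<bar> * (D + E)"
    using \<open>1 \<le> \<bar>b n\<bar>\<close> \<open>D > 0\<close> \<open>E \<ge> 0\<close> by (simp add: mult_le_cancel_right1)
  ultimately have "D + E \<le> M * E"
    by simp
  then show False
    using \<open>M * E \<le> D\<close> \<open>D > 0\<close> \<open>E \<ge> 0\<close> by (cases "E = 0") auto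
qed

section \<open>Binary logarithms of gaps\<close>

lemma floor_log_add_eq:
  assumes "m > 0" "n > 0" "floor_log m = floor_log n"
  shows "floor_log (m + n) = Suc (floor_log m)"
proof (rule floor_log_eqI)
  have "2 ^ floor_log m \<le> m" "2 ^ floor_log m \<le> n" 
       "m < 2 * 2 ^ floor_log m" "n < 2 * 2 ^ floor_log m"
    using assms floor_log_exp2_le[of m] floor_log_exp2_le[of n]
      floor_log_exp2_gt[of m] floor_log_exp2_gt[of n] by simp_all
  then show "2 ^ Suc (floor_log m) \<le> m + n" "m + n < 2 * 2 ^ Suc (floor_log m)"
    by auto
qed (use assms in auto)

text \<open>The logarithms differ by at least \<open>p + 2\<close>. One of the two extra factors 2
  pays for rounding \<open>m\<close> down to a power of two, the other is the 2 of the conclusion,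
  and \<open>2 ^ p\<close> exceeds \<open>p\<close>.\<close>

lemma floor_log_gap:
  assumes "m > 0" "n > 0" "floor_log m < floor_log n"
    and "floor_log m mod (p + 2) = floor_log n mod (p + 2)"
  shows "2 * p * m \<le> n"
proof -
  have "p + 2 \<le> floor_log n - floor_log m"
    using assms mod_eq_dvd_iff_nat[of "floor_log m" "floor_log n" "p + 2"]
    by (intro dvd_imp_le) auto
  then have "floor_log m + (p + 2) \<le> floor_log n"
    using assms by linarith
  then have "(2::nat) ^ (floor_log m + (p + 2)) \<le> 2 ^ floor_log n"
    by (intro power_increasing) auto
  also have "\<dots> \<le> n"
    using assms by (simp add: floor_log_exp2_le)
  finally have "2 * 2 ^ p * (2 * 2 ^ floor_log m) \<le> n"
    by (simp add: power_add mult_ac)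
  moreover have "2 * p * m \<le> 2 * 2 ^ p * (2 * 2 ^ floor_log m)"
    using floor_log_exp2_gt[of m] less_exp[of p] by (intro mult_mono) auto
  ultimately show ?thesis by linarith
qed

section \<open>Excluding monochromatic solutions\<close>

text \<open>The arithmetic core, with monochromaticity reduced to consecutive pairs and triples and
  the pair \<open>0, 2\<close>. The end coefficients matter because the unique minimal valuation or
  the dominating gap lies at an end.\<close>

lemma sum_neq_0_monochromatic:
  fixes y :: "nat \<Rightarrow> nat" and b :: "nat \<Rightarrow> int"
  assumes "prime p" and bp: "(\<Sum>j\<le>n. \<bar>b j\<bar>) < int p" and "n \<ge> 2"
    and inc: "\<And>j. j < n \<Longrightarrow> y j < y (Suc j)"
    and pos: "\<And>j. j \<le> n \<Longrightarrow> y j > 0"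
    and b0: "b 0 \<noteq> 0" and bn: "b n \<noteq> 0"
    and pair: "\<And>j. j < n \<Longrightarrow> pair_colour p (y j) (y (Suc j)) = c"
    and pair02: "pair_colour p (y 0) (y 2) = c"
    and triple: "\<And>j. Suc j < n \<Longrightarrow>
      cmp (floor_log (y (Suc j) - y j)) (floor_log (y (Suc (Suc j)) - y (Suc j))) = t"
  shows "(\<Sum>j\<le>n. b j * int (y j)) \<noteq> 0"
proof
  assume eq: "(\<Sum>j\<le>n. b j * int (y j)) = 0"
  define v where "v j = multiplicity p (y j)" for j
  \<comment> \<open>Applied to single coefficients, to make them prime to \<open>p\<close>, and
    later to their sum, to make it vanish.\<close>
  have small_dvd: "x = 0" if "int p dvd x" "\<bar>x\<bar> \<le> (\<Sum>j\<le>n. \<bar>b j\<bar>)" for x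
    using that bp zdvd_imp_le[of "int p" "\<bar>x\<bar>"] by (cases "x = 0") auto
  have ndvd: "\<not> int p dvd b j" if "j \<le> n" "b j \<noteq> 0" for j
    using small_dvd[of "b j"] that member_le_sum[of j "{..n}" "\<lambda>j. \<bar>b j\<bar>"] by auto
  have cmp_v: "cmp (v j) (v (Suc j)) = cmp (v 0) (v (Suc 0))" if "j < n" for j
  proof -
    have "pair_colour p (y j) (y (Suc j)) = pair_colour p (y 0) (y (Suc 0))"
      using pair[of j] pair[of 0] that by simp
    then show ?thesis by (simp add: pair_colour_def v_def)
  qed
  have gap: "floor_log (y (Suc j) - y j) mod (p + 2) = snd (snd c)" if "j < n" for j
    using pair[OF that] by (auto simp: pair_colour_def)
  have "\<not> v 0 < v (Suc 0)"
  proof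
    assume "v 0 < v (Suc 0)"
    then have step: "v j < v (Suc j)" if "j < n" for j
      using cmp_v[OF that] \<open>v 0 < v (Suc 0)\<close> by (simp add: cmp_def)
    have "0 < j \<Longrightarrow> j \<le> n \<Longrightarrow> v 0 < v j" for j
    proof (induction j)
      case (Suc j)
      then show ?case using step[of j] by (cases "j = 0") auto
    qed simp
    then show False
      using sum_neq_0_unique_min_multiplicity[of p "{..n}" 0 y b] eq pos ndvd b0 \<open>prime p\<close>
      by (auto simp: v_def)
  qed
  moreover have "\<not> v (Suc 0) < v 0"
  proof
    assume "v (Suc 0) < v 0"
    then have step: "v (Suc j) < v j" if "j < n" for j
      using cmp_v[OF that] \<open>v (Suc 0) < v 0\<close> by (simp add: cmp_def)
    have "v n < v j" if "j < n" for j
      using that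
    proof (induction j rule: strict_inc_induct)
      case (base i)
      then show ?case using step[of i] by simp
    next
      case (step i)
      then show ?case using \<open>\<And>j. j < n \<Longrightarrow> v (Suc j) < v j\<close>[of i] by simp
    qed
    then show False
      using sum_neq_0_unique_min_multiplicity[of p "{..n}" n y b] eq pos ndvd bn \<open>prime p\<close>
      by (auto simp: v_def)
  qed
  ultimately have vstep: "v (Suc j) = v j" if "j < n" for j
    using cmp_v[OF that] by (auto simp: cmp_def)
  \<comment> \<open>As \<open>y 1\<close> is the second entry of one pair and the first entry of the
    next, both digit components of \<open>c\<close> coincide.\<close>
  have dstep: "last_nonzero_digit p (y (Suc j)) = last_nonzero_digit p (y j)" if "j < n" for j
  proof -
    have "last_nonzero_digit p (y j) = fst (fst c)" "last_nonzero_digit p (y (Suc j)) = snd (fst c)"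
      using pair[OF that] by (auto simp: pair_colour_def)
    moreover have "last_nonzero_digit p (y 1) = snd (fst c)" "last_nonzero_digit p (y 1) = fst (fst c)"
      using pair[of 0] pair[of 1] \<open>n \<ge> 2\<close> by (auto simp: pair_colour_def)
    ultimately show ?thesis by simp
  qed
  have const: "v j = v 0 \<and> last_nonzero_digit p (y j) = last_nonzero_digit p (y 0)" if "j \<le> n" for j
    using that by (induction j) (use vstep dstep in auto)
  have "int p dvd (\<Sum>j\<le>n. b j)"
  proof (rule prime_dvd_coeff_sum_if_same_multiplicity[OF \<open>prime p\<close> _ _ _ _ _ eq])
    show "multiplicity p (y j) = multiplicity p (y 0)" if "j \<in> {..n}" for j
      using const[of j] that by (simp add: v_def)
    show "last_nonzero_digit p (y j) = last_nonzero_digit p (y 0)" if "j \<in> {..n}" for j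
      using const[of j] that by blast
  qed (use pos in auto)
  then have b_sum: "(\<Sum>j\<le>n. b j) = 0"
    by (intro small_dvd) auto
  define g where "g j = floor_log (y (Suc j) - y j)" for j
  have g: "cmp (g j) (g (Suc j)) = cmp (g 0) (g (Suc 0))" if "Suc j < n" for j
    using triple[OF that] triple[of 0] that by (simp add: g_def)
  have "g 0 \<noteq> g (Suc 0)"
  proof
    assume "g 0 = g (Suc 0)"
    moreover have y012: "y 0 < y 1" "y 1 < y 2"
      using inc[of 0] inc[of 1] \<open>n \<ge> 2\<close> by (auto simp: numeral_2_eq_2)
    ultimately have "floor_log ((y 1 - y 0) + (y 2 - y 1)) = Suc (g 0)"
      using floor_log_add_eq[of "y 1 - y 0" "y 2 - y 1"] by (auto simp: g_def numeral_2_eq_2)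
    then have "Suc (g 0) mod (p + 2) = snd (snd c)"
      using pair02 y012 by (auto simp: pair_colour_def)
    moreover have "g 0 mod (p + 2) = snd (snd c)"
      using gap[of 0] \<open>n \<ge> 2\<close> by (simp add: g_def)
    ultimately have "p + 2 dvd Suc (g 0) - g 0"
      using mod_eq_dvd_iff_nat[of "g 0" "Suc (g 0)" "p + 2"] by simp
    then show False by simp
  qed
  have gmod: "g i mod (p + 2) = g j mod (p + 2)" if "i < n" "j < n" for i j
    using gap that by (simp add: g_def)
  from \<open>g 0 \<noteq> g (Suc 0)\<close> consider "g 0 < g (Suc 0)" | "g (Suc 0) < g 0"
    by linarith
  then show False
  proof cases
    case 1
    have "g j < g (Suc j)" if "Suc j < n" for j
      using g[OF that] 1 by (simp add: cmp_def)
    then have lac: "2 * p * (y (Suc j) - y j) \<le> y (Suc (Suc j)) - y (Suc j)" if "Suc j < n" for j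
      using that inc[of j] inc[of "Suc j"] gmod[of j "Suc j"]
      by (intro floor_log_gap) (auto simp: g_def)
    have lac': "2 * int p * (int (y (Suc j)) - int (y j)) \<le> int (y (Suc (Suc j))) - int (y (Suc j))"
      if "Suc j < n" for j
      using of_nat_mono[OF lac[OF that], where ?'a = int] inc[of j] inc[of "Suc j"] that
      by (simp add: of_nat_diff)
    have "(\<Sum>j\<le>n. b j * int (y j)) \<noteq> 0"
    proof (rule sum_neq_0_lacunary[of n "\<lambda>j. int (y j)" "int p"])
      show "(\<Sum>j\<le>n. \<bar>b j\<bar>) \<le> int p"
        using bp by simp
    qed (use lac' inc b_sum bn \<open>n \<ge> 2\<close> in simp_all)
    with eq show False by contradiction
  next
    case 2
    have "g (Suc j) < g j" if "Suc j < n" for j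
      using g[OF that] 2 by (simp add: cmp_def)
    then have lac: "2 * p * (y (Suc (Suc j)) - y (Suc j)) \<le> y (Suc j) - y j" if "Suc j < n" for j
      using that inc[of j] inc[of "Suc j"] gmod[of j "Suc j"]
      by (intro floor_log_gap) (auto simp: g_def)
    have lac': "2 * int p * (int (y (Suc (Suc j))) - int (y (Suc j))) \<le> int (y (Suc j)) - int (y j)"
      if "Suc j < n" for j
      using of_nat_mono[OF lac[OF that], where ?'a = int] inc[of j] inc[of "Suc j"] that
      by (simp add: of_nat_diff)
    \<comment> \<open>reversal and negation turn decaying gaps into growing ones\<close>
    define z where "z j = - int (y (n - j))" for j
    have rev: "(\<Sum>j\<le>n. f (n - j)) = (\<Sum>j\<le>n. f j)" for f :: "nat \<Rightarrow> int"
      by (rule sum.reindex_bij_witness[of _ "\<lambda>j. n - j" "\<lambda>j. n - j"]) auto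
    have "(\<Sum>j\<le>n. b (n - j) * z j) \<noteq> 0"
    proof (rule sum_neq_0_lacunary[of n z "int p"])
      show "z j < z (Suc j)" if "j < n" for j
        using inc[of "n - Suc j"] that by (simp add: z_def Suc_diff_Suc)
      show "2 * int p * (z (Suc j) - z j) \<le> z (Suc (Suc j)) - z (Suc j)" if "Suc j < n" for j
        using lac'[of "n - Suc (Suc j)"] that by (simp add: z_def Suc_diff_Suc)
      show "(\<Sum>j\<le>n. \<bar>b (n - j)\<bar>) \<le> int p"
        using bp rev[of "\<lambda>j. \<bar>b j\<bar>"] by simp
      show "(\<Sum>j\<le>n. b (n - j)) = 0"
        using b_sum rev[of b] by simp
    qed (use b0 \<open>n \<ge> 2\<close> in auto)
    moreover have "(\<Sum>j\<le>n. b (n - j) * z j) = - (\<Sum>j\<le>n. b j * int (y j))"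
      using rev[of "\<lambda>j. b j * int (y j)"] by (simp add: z_def sum_negf)
    ultimately show False using eq by simp
  qed
qed

section \<open>From colourings of \<open>r\<close>-sets to consecutive terms\<close>

text \<open>Renumbering the finite set \<open>F\<close> injectively permits structured colours in
  place of numbers below \<open>m\<close>.\<close>

lemma graph_regular_finite_colouring:
  assumes "graph_regular r k a" "finite F" "c \<in> [{1..}]\<^bsup>r\<^esup> \<rightarrow> F"
  obtains x :: "nat \<Rightarrow> nat" where "\<forall>i\<in>{1..k}. x i > 0" "inj_on x {1..k}"
    "(\<Sum>i=1..k. a i * int (x i)) = 0"
    "\<And>S T. S \<in> [x ` {1..k}]\<^bsup>r\<^esup> \<Longrightarrow> T \<in> [x ` {1..k}]\<^bsup>r\<^esup> \<Longrightarrow> c S = c T"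
proof -
  obtain f and m :: nat where f: "f ` F = {i. i < m}" "inj_on f F"
    using finite_imp_inj_to_nat_seg[OF \<open>finite F\<close>] by blast
  have "(\<lambda>S. f (c S)) \<in> [{1..}]\<^bsup>r\<^esup> \<rightarrow> {..<m}"
  proof (rule Pi_I)
    fix S :: "nat set" assume "S \<in> [{1..}]\<^bsup>r\<^esup>"
    then have "f (c S) \<in> f ` F"
      using funcset_mem[OF assms(3)] by (intro imageI)
    then show "f (c S) \<in> {..<m}"
      by (simp add: f(1))
  qed
  then obtain x t where x: "\<forall>i\<in>{1..k}. x i > 0" "inj_on x {1..k}"
    "(\<Sum>i=1..k. a i * int (x i)) = 0" "\<forall>S\<in>[x ` {1..k}]\<^bsup>r\<^esup>. f (c S) = t"
    using assms(1)[unfolded graph_regular_def, rule_format, of "\<lambda>S. f (c S)" m] by blast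
  have "[x ` {1..k}]\<^bsup>r\<^esup> \<subseteq> [{1..}]\<^bsup>r\<^esup>"
    using x(1) by (intro nsets_mono) (auto simp: Suc_le_eq)
  \<comment> \<open>The renumbering is injective only on \<open>F\<close>, so the colours compared
    must be known to lie there.\<close>
  then have in_F: "c S \<in> F" if "S \<in> [x ` {1..k}]\<^bsup>r\<^esup>" for S
    using that by (intro funcset_mem[OF assms(3)]) blast
  have "c S = c T" if "S \<in> [x ` {1..k}]\<^bsup>r\<^esup>" "T \<in> [x ` {1..k}]\<^bsup>r\<^esup>" for S T
  proof (rule inj_onD[OF f(2)])
    show "f (c S) = f (c T)"
      using x(4) that by simp
  qed (use in_F that in auto)
  with x(1-3) show ?thesis
    by (rule that)
qed

lemma finite_set_colour:
  assumes "p > 0"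
  obtains F where "finite F" "set_colour p r \<in> A \<rightarrow> F"
proof
  define P where "P = ({..<p} \<times> {..<p}) \<times> (UNIV :: (bool \<times> bool) set) \<times> {..<p + 2}"
  let ?F = "{l. set l \<subseteq> P \<times> P \<times> (UNIV :: (bool \<times> bool) set) \<and> length l = r - 2}"
  show "finite ?F"
    by (intro finite_lists_length_eq) (auto simp: P_def)
  have *: "triple_colour p x y z \<in> P \<times> P \<times> UNIV" for x y z
    using assms by (auto simp: triple_colour_def pair_colour_def last_nonzero_digit_def P_def)
  then show "set_colour p r \<in> A \<rightarrow> ?F"
    unfolding set_colour_def Let_def 
    by (intro Pi_I CollectI conjI) (use * in \<open>simp_all add: image_subset_iff\<close>)
qed

lemma set_colour_strict_sorted:
  assumes "sorted_wrt (<) l"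
  shows "set_colour p r (set l) =
    map (\<lambda>i. triple_colour p (l ! i) (l ! (i + 1)) (l ! (i + 2))) [0..<r - 2]"
  using assms
  by (simp add: set_colour_def Let_def strict_sorted_iff sorted_list_of_set.idem_if_sorted_distinct)

text \<open>Shifting a window of \<open>r\<close> consecutive entries by one replaces each triple by
  its successor at the same position of the colour, so neighbouring triples agree.\<close>

lemma monochromatic_consecutive:
  fixes l :: "nat list"
  assumes l: "sorted_wrt (<) l" and "r \<ge> 3" "length l \<ge> r + 1"
    and mono: "\<forall>S\<in>[set l]\<^bsup>r\<^esup>. \<forall>T\<in>[set l]\<^bsup>r\<^esup>. set_colour p r S = set_colour p r T"
  shows "\<And>j. j + 2 < length l \<Longrightarrow>
      triple_colour p (l ! j) (l ! (j + 1)) (l ! (j + 2)) = triple_colour p (l ! 0) (l ! 1) (l ! 2)"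
    and "pair_colour p (l ! 0) (l ! 2) = pair_colour p (l ! 0) (l ! 1)"
proof -
  define t where "t l i = triple_colour p (l ! i) (l ! (i + 1)) (l ! (i + 2))" for l i
  have sub: "t xs i = t ys i"
    if "subseq xs l" "subseq ys l" "length xs = r" "length ys = r" "i < r - 2" for xs ys i
  proof -
    \<comment> \<open>A subsequence of \<open>l\<close> is itself the sorted list of its set, so its
      entries can be read off from the colour.\<close>
    have *: "sorted_wrt (<) zs \<and> set zs \<in> [set l]\<^bsup>r\<^esup>" if "subseq zs l" "length zs = r" for zs
    proof -
      have zs: "sorted_wrt (<) zs"
        using that(1) l by (metis subseq_conv_nths sorted_nths distinct_nthsI strict_sorted_iff)
      then have "card (set zs) = r"
        using that(2) by (simp add: strict_sorted_iff distinct_card)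
      moreover have "set zs \<subseteq> set l"
        using that(1) by (metis subseq_conv_nths set_nths_subset)
      ultimately show ?thesis using zs by (simp add: nsets_def)
    qed
    have "map (t xs) [0..<r - 2] = map (t ys) [0..<r - 2]"
      using mono[rule_format, of "set xs" "set ys"] *[of xs] *[of ys] that
      by (simp add: set_colour_strict_sorted t_def)
    then show ?thesis
      using that by simp
  qed
  have window: "subseq (take r (drop j l)) l" for j
    by (meson subseq_order.trans sublist_imp_subseq sublist_take sublist_drop)
  have tw: "t (take r (drop j l)) i = t l (j + i)" if "i < r - 2" "j + r \<le> length l" for i j
    using that by (simp add: t_def add.assoc)
  have step: "t l (Suc q) = t l q" if "q + 3 < length l" for q
  proof -
    \<comment> \<open>The window starts at \<open>q\<close> if possible, and otherwise at the last
      position that still leaves room for the shifted window. Triple \<open>q\<close> then has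
      offset \<open>q - j\<close>, which stays below \<open>r - 2\<close>.\<close>
    define j where "j = min q (length l - r - 1)"
    have j: "q - j < r - 2" "j + 1 + r \<le> length l" "j + (q - j) = q" "Suc j + (q - j) = Suc q"
      using that assms by (auto simp: j_def min_def)
    then show ?thesis
      using sub[OF window window, of "Suc j" j "q - j"] tw[of "q - j" j] tw[of "q - j" "Suc j"] by simp
  qed
  have "j + 2 < length l \<Longrightarrow> t l j = t l 0" for j
    by (induction j) (auto simp: step)
  then show "j + 2 < length l \<Longrightarrow>
      triple_colour p (l ! j) (l ! (j + 1)) (l ! (j + 2)) = triple_colour p (l ! 0) (l ! 1) (l ! 2)" for j
    by (metis t_def add_0)
  \<comment> \<open>dropping the second element turns the pair \<open>0, 2\<close> into the first pair of an \<open>r\<close>-set\<close>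
  let ?ys = "l ! 0 # take (r - 1) (drop 2 l)"
  \<comment> \<open>The rule \<open>remdups_adj.cases\<close> serves only to split lists into those
    with no, one, or at least two entries.\<close>
  have "l = l ! 0 # l ! 1 # drop 2 l"
    using \<open>length l \<ge> r + 1\<close> \<open>r \<ge> 3\<close>
    by (cases l rule: remdups_adj.cases) (simp_all add: numeral_2_eq_2)
  then have "subseq ?ys l"
    by (metis subseq_Cons' subseq_Cons2 subseq_order.refl subseq_order.trans sublist_imp_subseq sublist_take list_emb_Cons)
  then have "t ?ys 0 = t (take r (drop 0 l)) 0"
    using window[of 0] assms by (intro sub) auto
  then show "pair_colour p (l ! 0) (l ! 2) = pair_colour p (l ! 0) (l ! 1)"
    using assms by (simp add: t_def triple_colour_def)
qed

section \<open>Assembling the contradiction\<close>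

theorem theorem5p1:
  fixes r k :: nat and a :: "nat \<Rightarrow> int"
  assumes "r \<ge> 3" and "k \<ge> r + 1"
    and "\<And>i. i \<in> {1..k} \<Longrightarrow> a i \<noteq> 0"
  shows "\<not> graph_regular r k a"
proof
  assume reg: "graph_regular r k a"
  obtain p where p: "prime p" "nat (\<Sum>i=1..k. \<bar>a i\<bar>) < p"
    using bigger_prime by blast
  obtain F where "finite F" "set_colour p r \<in> [{1..}]\<^bsup>r\<^esup> \<rightarrow> F"
    using finite_set_colour p prime_gt_0_nat by metis
  with reg obtain x where x: "\<forall>i\<in>{1..k}. x i > 0" "inj_on x {1..k}"
    "(\<Sum>i=1..k. a i * int (x i)) = 0"
    and mono: "\<And>S T. S \<in> [x ` {1..k}]\<^bsup>r\<^esup> \<Longrightarrow> T \<in> [x ` {1..k}]\<^bsup>r\<^esup> \<Longrightarrow>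
      set_colour p r S = set_colour p r T"
    by (rule graph_regular_finite_colouring) blast
  define l where "l = sorted_list_of_set (x ` {1..k})"
  have l: "sorted_wrt (<) l" "set l = x ` {1..k}" "length l = k"
    using x(2) by (simp_all add: l_def card_image)
  define n where "n = k - 1"
  have n: "k = Suc n" "n \<ge> 3"
    using assms by (auto simp: n_def)
  have idx: "{..n} = {..<length l}"
    using l n by auto
  \<comment> \<open>Sorting the solution permutes its terms; each coefficient follows its value
    through the inverse of \<open>x\<close>.\<close>
  define b where "b j = a (inv_into {1..k} x (l ! j))" for j
  have "inv_into {1..k} x (l ! j) \<in> {1..k}" if "j \<le> n" for j
    using that l n by (metis inv_into_into le_imp_less_Suc nth_mem)
  then have b: "b j \<noteq> 0" if "j \<le> n" for j
    using that assms(3) by (simp add: b_def)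
  have bij: "bij_betw (\<lambda>i. l ! i) {..n} (x ` {1..k})"
    using bij_betw_nth[of l "{..n}" "x ` {1..k}"] l idx by (simp add: strict_sorted_iff)
  \<comment> \<open>Since \<open>h\<close> sees both index and value, this covers the sum of
    absolute coefficients as well as the equation itself.\<close>
  have reindex: "(\<Sum>j\<le>n. h (inv_into {1..k} x (l ! j)) (l ! j)) = (\<Sum>i=1..k. h i (x i))"
    for h :: "nat \<Rightarrow> nat \<Rightarrow> int"
  proof -
    have "(\<Sum>j\<le>n. h (inv_into {1..k} x (l ! j)) (l ! j)) = (\<Sum>u\<in>x ` {1..k}. h (inv_into {1..k} x u) u)"
      using sum.reindex_bij_betw[OF bij] .
    also have "\<dots> = (\<Sum>i=1..k. h i (x i))"
      using x(2) by (simp add: sum.reindex)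
    finally show ?thesis .
  qed
  have len: "length l \<ge> r + 1"
    using l assms by simp
  have mono': "\<forall>S\<in>[set l]\<^bsup>r\<^esup>. \<forall>T\<in>[set l]\<^bsup>r\<^esup>. set_colour p r S = set_colour p r T"
    using mono unfolding l(2) by blast
  note cons = monochromatic_consecutive[OF l(1) \<open>r \<ge> 3\<close> len mono']
  have trip: "triple_colour p (l ! j) (l ! Suc j) (l ! Suc (Suc j)) = triple_colour p (l ! 0) (l ! 1) (l ! 2)"
    if "Suc j < n" for j
    using cons(1)[of j] that l n by simp
  have "(\<Sum>j\<le>n. b j * int (l ! j)) \<noteq> 0"
  proof (rule sum_neq_0_monochromatic[OF \<open>prime p\<close>])
    show "(\<Sum>j\<le>n. \<bar>b j\<bar>) < int p"
      using reindex[of "\<lambda>i _. \<bar>a i\<bar>"] p by (simp add: b_def)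
    show "l ! j < l ! Suc j" if "j < n" for j
      using that l n by (simp add: sorted_wrt_nth_less)
    show "l ! j > 0" if "j \<le> n" for j
    proof -
      have "l ! j \<in> x ` {1..k}"
        using that l n by (metis le_imp_less_Suc nth_mem)
      then show ?thesis using x(1) by auto
    qed
    show "pair_colour p (l ! j) (l ! Suc j) = pair_colour p (l ! 0) (l ! 1)" if jn: "j < n" for j
    proof (cases "Suc j < n")
      case True
      then show ?thesis using trip[of j] by (simp add: triple_colour_def)
    next
      case False
      \<comment> \<open>The last pair begins no triple but ends the triple at \<open>i\<close>,
        hence has the colour of the pair \<open>1, 2\<close>. The triple at 1, available since
        \<open>n\<close> is at least 3, identifies that with the colour of the pair
        \<open>0, 1\<close>.\<close>
      then obtain i where "j = Suc i" "Suc i < n" using jn n by (cases j) auto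
      then show ?thesis
        using trip[of i] trip[of 1] trip[of 0] n by (simp add: triple_colour_def numeral_2_eq_2)
    qed
    show "pair_colour p (l ! 0) (l ! 2) = pair_colour p (l ! 0) (l ! 1)"
      by (fact cons(2))
    show "cmp (floor_log (l ! Suc j - l ! j)) (floor_log (l ! Suc (Suc j) - l ! Suc j)) =
      cmp (floor_log (l ! 1 - l ! 0)) (floor_log (l ! 2 - l ! 1))" if "Suc j < n" for j
      using trip[OF that] by (simp add: triple_colour_def)
  qed (use b n in auto)
  moreover have "(\<Sum>j\<le>n. b j * int (l ! j)) = 0"
    using reindex[of "\<lambda>i u. a i * int u"] x(3) by (simp add: b_def)
  ultimately show False by simp
qed

end
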